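(* Let $G$ be a binary tree with $n$ boundary vertices, and fix a vertex of $G$ of degree $3$, called the center. Let $Q=Q(G)$ be the $m\times m$ matrix of $G$ defined in the context, where $m=2n-3$ is the number of edges of $G$. Then $$\det Q=\frac{4}{\prod_{i}(n-n(i))^2}\cdot\prod_{\{j,k\}}\left[4\left(\frac{n}{n(k)+n(j)}-1\right)\right],$$ where the first product is over all edges $i$ of $G$ and the second product is over all unordered pairs $\{j,k\}$ of distinct edges of $G$ such that $j$ and $k$ are adjacent (share a vertex) and $l(j)=l(k)\neq 0$.
   Context: A binary tree is a finite tree in which every vertex has degree $1$ or $3$; its boundary vertices are exactly its vertices of degree $1$. A binary tree with $n$ boundary vertices has $m=2n-3$ edges, enumerated by $1,\dots,m$ in some way. For an edge $i$ let $q_i$ be the number of unordered pairs of distinct boundary vertices whose connecting path contains $i$ (equivalently, the product of the numbers of boundary vertices on the two sides of $i$). The matrix $Q=(Q_{ij})$ is defined by: $Q_{ij}$ is the number of unordered pairs of distinct boundary vertices such that the path connecting them contains both edge $i$ and edge $j$, divided by $q_iq_j$. (In particular $Q_{ii}=1/q_i$.) Relative to the chosen center: $n(i)$ is the number of boundary vertices $v$ such that the path from the center to $v$ contains the edge $i$; the level $l(i)$ of an edge $i$ is the number of edges in the path connecting the center with the vertex incident to $i$ closest to the center (so the three edges incident to the center have level $0$). *)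

theory Defs
  imports Complex_Main "Jordan_Normal_Form.Determinant"
begin

text \<open>Finite simple graphs are given by a vertex set \<open>V\<close> and a set \<open>E\<close> of two-element
  subsets of \<open>V\<close>. Paths are nonempty lists of pairwise distinct vertices.\<close>

definition simple_graph :: "'a set \<Rightarrow> 'a set set \<Rightarrow> bool" where
  "simple_graph V E \<longleftrightarrow> finite V \<and> (\<forall>e\<in>E. e \<subseteq> V \<and> card e = 2)"

definition is_path :: "'a set \<Rightarrow> 'a set set \<Rightarrow> 'a \<Rightarrow> 'a list \<Rightarrow> 'a \<Rightarrow> bool" where
  "is_path V E u p v \<longleftrightarrow> p \<noteq> [] \<and> set p \<subseteq> V \<and> distinct p \<and>
     successively (\<lambda>x y. {x, y} \<in> E) p \<and> hd p = u \<and> last p = v"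

text \<open>A cycle is listed without repeating its initial vertex.\<close>

definition is_cycle :: "'a set \<Rightarrow> 'a set set \<Rightarrow> 'a list \<Rightarrow> bool" where
  "is_cycle V E p \<longleftrightarrow> length p \<ge> 3 \<and> set p \<subseteq> V \<and> distinct p \<and>
     successively (\<lambda>x y. {x, y} \<in> E) p \<and> {last p, hd p} \<in> E"

definition is_tree :: "'a set \<Rightarrow> 'a set set \<Rightarrow> bool" where
  "is_tree V E \<longleftrightarrow> simple_graph V E \<and> V \<noteq> {} \<and>
     (\<forall>u\<in>V. \<forall>v\<in>V. \<exists>p. is_path V E u p v) \<and> (\<nexists>p. is_cycle V E p)"

definition vdegree :: "'a set set \<Rightarrow> 'a \<Rightarrow> nat" where
  "vdegree E v = card {e \<in> E. v \<in> e}"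

definition binary_tree :: "'a set \<Rightarrow> 'a set set \<Rightarrow> bool" where
  "binary_tree V E \<longleftrightarrow> is_tree V E \<and> (\<forall>v\<in>V. vdegree E v = 1 \<or> vdegree E v = 3)"

definition boundary :: "'a set \<Rightarrow> 'a set set \<Rightarrow> 'a set" where
  "boundary V E = {v \<in> V. vdegree E v = 1}"

text \<open>The path between two given vertices exists uniquely only in a tree; the notions below are
  meant for trees only.\<close>

definition tree_path :: "'a set \<Rightarrow> 'a set set \<Rightarrow> 'a \<Rightarrow> 'a \<Rightarrow> 'a list" where
  "tree_path V E u v = (THE p. is_path V E u p v)"

definition path_edges :: "'a set \<Rightarrow> 'a set set \<Rightarrow> 'a \<Rightarrow> 'a \<Rightarrow> 'a set set" where
  "path_edges V E u v = (let p = tree_path V E u v in {{p ! k, p ! Suc k} | k. Suc k < length p})"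

text \<open>Unordered pairs of distinct boundary vertices whose connecting path contains all edges
  in \<open>F\<close>.\<close>

definition pairs_through :: "'a set \<Rightarrow> 'a set set \<Rightarrow> 'a set set \<Rightarrow> 'a set set" where
  "pairs_through V E F =
     {{u, v} | u v. u \<in> boundary V E \<and> v \<in> boundary V E \<and> u \<noteq> v \<and> F \<subseteq> path_edges V E u v}"

definition q :: "'a set \<Rightarrow> 'a set set \<Rightarrow> 'a set \<Rightarrow> nat" where
  "q V E i = card (pairs_through V E {i})"

definition Q_entry :: "'a set \<Rightarrow> 'a set set \<Rightarrow> 'a set \<Rightarrow> 'a set \<Rightarrow> real" where
  "Q_entry V E i j = real (card (pairs_through V E {i, j})) / (real (q V E i) * real (q V E j))"

text \<open>The matrix depends on an enumeration \<open>e 0, \<dots>, e (m - 1)\<close> of the edges.\<close>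

definition Q_mat :: "'a set \<Rightarrow> 'a set set \<Rightarrow> nat \<Rightarrow> (nat \<Rightarrow> 'a set) \<Rightarrow> real mat" where
  "Q_mat V E m e = mat m m (\<lambda>(a, b). Q_entry V E (e a) (e b))"

text \<open>For a chosen center \<open>c\<close>, \<open>n_beyond V E c i\<close> is $n(i)$ and \<open>level V E c i\<close> is $l(i)$.\<close>

definition n_beyond :: "'a set \<Rightarrow> 'a set set \<Rightarrow> 'a \<Rightarrow> 'a set \<Rightarrow> nat" where
  "n_beyond V E c i = card {v \<in> boundary V E. i \<in> path_edges V E c v}"

definition level :: "'a set \<Rightarrow> 'a set set \<Rightarrow> 'a \<Rightarrow> 'a set \<Rightarrow> nat" where
  "level V E c i = Min ((\<lambda>v. card (path_edges V E c v)) ` i)"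

definition sibling_pairs :: "'a set \<Rightarrow> 'a set set \<Rightarrow> 'a \<Rightarrow> 'a set set set" where
  "sibling_pairs V E c =
     {{j, k} | j k. j \<in> E \<and> k \<in> E \<and> j \<noteq> k \<and> j \<inter> k \<noteq> {} \<and>
        level V E c j = level V E c k \<and> level V E c j \<noteq> 0}"

end

theory Submission
  imports Defs
begin

text \<open>
  Root the tree at the center and index each edge by its lower end. Write \<open>n(x)\<close> for the number of
  leaves below \<open>x\<close>. The path between two leaves contains the edge of \<open>x\<close> if and only if exactly
  one of the two leaves is below \<open>x\<close> (\<open>path_edges_iff\<close>). Counting pairs of leaves gives
  \<open>Q(x,y) = 1 / (n(x) (n - n(y)))\<close> if \<open>x\<close> is an ancestor of \<open>y\<close> or equal to it, and
  \<open>Q(x,y) = 1 / ((n - n(x)) (n - n(y)))\<close> if \<open>x\<close> and \<open>y\<close> are incomparable. Taking the factor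
  \<open>1 / (n - n(x))\<close> out of each row and each column therefore yields the first product of the formula
  and a matrix \<open>M\<close> whose entry at two comparable vertices is \<open>f(x) = n / n(x) - 1\<close> for the upper
  one \<open>x\<close>, and whose other entries are \<open>1\<close> (\<open>Q_entry_parent_edge\<close>).

  The rows of \<open>M\<close> at a vertex \<open>u\<close> and at a child of \<open>u\<close> agree in every column that is not strictly
  below \<open>u\<close> (\<open>scaled_rows_agree\<close>). Subtracting from each row the row of the parent thus makes the
  matrix block triangular, with one block for each set of siblings. The \<open>3\<times>3\<close> block at the center has
  determinant \<open>4\<close>, because the numbers \<open>n(x)\<close> of its three members add up to \<open>n\<close>. The \<open>2\<times>2\<close> block
  of the children of \<open>u\<close> has determinant \<open>4 f(u)\<close>, because \<open>n(u)\<close> is the sum of the two numbers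
  \<open>n(x)\<close> of its members. These pairs of children are exactly the sibling pairs of nonzero level.
  The elimination is carried out one sibling pair at a time, from the deepest pairs upwards
  (\<open>det_on_append_children\<close>, \<open>det_scaled_below\<close>).
\<close>

section \<open>Determinants indexed by finite sets\<close>

text \<open>Matrices whose rows and columns are indexed by the elements of a finite set. The determinant
  does not depend on the enumeration that turns such a family into a matrix, so an arbitrary one
  is chosen. This permits induction on the index set.\<close>

definition det_on :: "'b set \<Rightarrow> ('b \<Rightarrow> 'b \<Rightarrow> real) \<Rightarrow> real" where
  "det_on A M = (let e = (SOME e. bij_betw e {..<card A} A) in
     det (mat (card A) (card A) (\<lambda>(i, j). M (e i) (e j))))"

text \<open>Two enumerations differ by a permutation, which acts on rows and columns at once; its sign
  therefore occurs twice and cancels.\<close>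

lemma det_mat_reorder:
  fixes M :: "'b \<Rightarrow> 'b \<Rightarrow> real"
  assumes e: "bij_betw e {..<m} A" and e': "bij_betw e' {..<m} A"
  shows "det (mat m m (\<lambda>(i, j). M (e' i) (e' j))) = det (mat m m (\<lambda>(i, j). M (e i) (e j)))"
proof -
  define s where "s = (\<lambda>i. if i < m then inv_into {..<m} e (e' i) else i)"
  have "bij_betw (inv_into {..<m} e \<circ> e') {..<m} {..<m}"
    using e e' bij_betw_inv_into bij_betw_trans by blast
  then have "bij_betw s {..<m} {..<m}"
    by (rule bij_betw_cong[THEN iffD1, rotated]) (simp add: s_def)
  then have s: "s permutes {0..<m}"
    by (intro bij_imp_permutes) (simp_all add: s_def atLeast0LessThan)
  have es: "e (s i) = e' i" if "i < m" for i
    using that bij_betwE[OF e'] bij_betw_inv_into_right[OF e] by (simp add: s_def)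
  have sm: "s i < m" if "i < m" for i
    using permutes_in_image[OF s, of i] that by simp
  let ?A = "mat m m (\<lambda>(i, j). M (e i) (e j))"
  let ?B = "mat m m (\<lambda>(i, j). ?A $$ (s i, j))"
  let ?C = "mat m m (\<lambda>(i, j). (transpose_mat ?B) $$ (s i, j))"
  have "det ?C = signof s * det (transpose_mat ?B)"
    by (rule det_permute_rows[OF _ s]) simp
  also have "det (transpose_mat ?B) = det ?B"
    by (rule det_transpose) (auto intro: mat_carrier)
  also have "det ?B = signof s * det ?A"
    by (rule det_permute_rows[OF _ s]) simp
  also have "signof s * (signof s * det ?A) = det ?A"
    by (simp add: sign_def)
  finally have "det ?C = det ?A" .
  moreover have "?C = transpose_mat (mat m m (\<lambda>(i, j). M (e' i) (e' j)))"
    by (rule eq_matI) (auto simp: es sm)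
  moreover have "det (transpose_mat (mat m m (\<lambda>(i, j). M (e' i) (e' j)))) =
      det (mat m m (\<lambda>(i, j). M (e' i) (e' j)))"
    by (rule det_transpose) (auto intro: mat_carrier)
  ultimately show ?thesis by simp
qed

lemma det_on_eq:
  assumes e: "bij_betw e {..<m} A"
  shows "det_on A M = det (mat m m (\<lambda>(i, j). M (e i) (e j)))"
proof -
  have m: "card A = m"
    using bij_betw_same_card[OF e] by simp
  have "bij_betw (SOME e. bij_betw e {..<m} A) {..<m} A"
    by (rule someI[of "\<lambda>e. bij_betw e {..<m} A", OF e])
  from det_mat_reorder[OF e this] show ?thesis
    by (simp add: det_on_def m Let_def)
qed

lemma finite_enum: "finite A \<Longrightarrow> \<exists>e. bij_betw e {..<card A} A"
  using ex_bij_betw_nat_finite[of A] by (auto simp: atLeast0LessThan)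

lemma det_on_scale:
  assumes "finite A"
  shows "det_on A (\<lambda>x y. d x * M x y * d y) = (\<Prod>x\<in>A. (d x)\<^sup>2) * det_on A M"
proof -
  obtain e where e: "bij_betw e {..<card A} A"
    using finite_enum[OF assms] by blast
  let ?m = "card A"
  let ?N = "mat ?m ?m (\<lambda>(i, j). M (e i) (e j))"
  let ?N' = "mat ?m ?m (\<lambda>(i, j). d (e i) * M (e i) (e j) * d (e j))"
  have prod: "(\<Prod>i = 0..<?m. ?N' $$ (i, p i)) =
      (\<Prod>x\<in>A. (d x)\<^sup>2) * (\<Prod>i = 0..<?m. ?N $$ (i, p i))"
    if p: "p permutes {0..<?m}" for p
  proof -
    have "(\<Prod>i = 0..<?m. d (e (p i))) = (\<Prod>i = 0..<?m. d (e i))"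
      using prod.permute[OF p, of "\<lambda>i. d (e i)"] by (simp add: o_def)
    moreover have "(\<Prod>i = 0..<?m. (d (e i))) = (\<Prod>x\<in>A. d x)"
      using prod.reindex_bij_betw[OF e, of d] by (simp add: atLeast0LessThan)
    moreover have "p i < ?m" if "i < ?m" for i
      using permutes_in_image[OF p, of i] that by simp
    ultimately show ?thesis
      by (simp add: prod.distrib power2_eq_square)
  qed
  have "det ?N' = (\<Prod>x\<in>A. (d x)\<^sup>2) * det ?N"
    unfolding det_def'[OF mat_carrier] sum_distrib_left
    by (rule sum.cong[OF refl], simp only: mem_Collect_eq prod mult.left_commute)
  then show ?thesis
    by (simp add: det_on_eq[OF e])
qed

text \<open>The elimination step. If on the columns in \<open>A\<close> every row indexed by \<open>C\<close> repeats the row of some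
  element \<open>r x\<close> of \<open>A\<close>, then subtracting that row clears the lower left block, and what is left
  in the lower right block is the difference of the two rows. The subtraction is written below as
  a factorization into a unitriangular and a block triangular matrix.\<close>

lemma det_on_append_children:
  assumes "finite A" "finite C" "A \<inter> C = {}" and r: "\<And>x. x \<in> C \<Longrightarrow> r x \<in> A"
    and rows: "\<And>x y. x \<in> C \<Longrightarrow> y \<in> A \<Longrightarrow> M x y = M (r x) y"
  shows "det_on (A \<union> C) M = det_on A M * det_on C (\<lambda>x y. M x y - M (r x) y)"
proof -
  let ?a = "card A" and ?c = "card C"
  obtain f g where f: "bij_betw f {..<?a} A" and g: "bij_betw g {..<?c} C"
    using finite_enum assms(1,2) by metis
  define e where "e i = (if i < ?a then f i else g (i - ?a))" for i
  have e: "bij_betw e {..<?a + ?c} (A \<union> C)"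
  proof -
    have "bij_betw e {..<?a} A"
      using f by (rule bij_betw_cong[THEN iffD1, rotated]) (simp add: e_def)
    moreover have "bij_betw e {?a..<?a + ?c} C"
    proof -
      have "bij_betw (\<lambda>i. i - ?a) {?a..<?a + ?c} {..<?c}"
        by (rule bij_betw_byWitness[where f' = "\<lambda>i. i + ?a"]) auto
      then have "bij_betw (g \<circ> (\<lambda>i. i - ?a)) {?a..<?a + ?c} C"
        using g bij_betw_trans by blast
      then show ?thesis
        by (rule bij_betw_cong[THEN iffD1, rotated]) (simp add: e_def)
    qed
    ultimately have "bij_betw e ({..<?a} \<union> {?a..<?a + ?c}) (A \<union> C)"
      using assms(3) by (rule bij_betw_combine)
    moreover have "{..<?a} \<union> {?a..<?a + ?c} = {..<?a + ?c}" by auto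
    ultimately show ?thesis by simp
  qed
  define s where "s i = inv_into {..<?a} f (r (g i))" for i
  have gC: "g i \<in> C" if "i < ?c" for i using g that by (auto simp: bij_betw_def)
  have fA: "f i \<in> A" if "i < ?a" for i using f that by (auto simp: bij_betw_def)
  have s: "s i < ?a" "f (s i) = r (g i)" if "i < ?c" for i
    using r[OF gC[OF that]] f inv_into_into[of "r (g i)" f "{..<?a}"]
    by (auto simp: s_def bij_betw_def f_inv_into_f)
  define A11 where "A11 = mat ?a ?a (\<lambda>(i, j). M (f i) (f j))"
  define A12 where "A12 = mat ?a ?c (\<lambda>(i, j). M (f i) (g j))"
  define A22 where "A22 = mat ?c ?c (\<lambda>(i, j). M (g i) (g j) - M (r (g i)) (g j))"
  \<comment> \<open>The matrix that selects, for each row in C, its representative in A.\<close>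
  define R where "R = mat ?c ?a (\<lambda>(i, j). if j = s i then 1 else (0::real))"
  have R_sum: "(\<Sum>j = 0..<?a. (if j = s i then 1 else 0) * h j) = h (s i)"
    if "i < ?c" for i and h :: "nat \<Rightarrow> real"
    using s(1)[OF that] by (simp add: if_distrib[of "\<lambda>x. x * _"] cong: if_cong)
  have R1: "R * A11 = mat ?c ?a (\<lambda>(i, j). M (g i) (f j))"
    by (rule eq_matI)
      (auto simp: R_def A11_def scalar_prod_def R_sum s gC fA rows)
  have R2: "R * A12 + A22 = mat ?c ?c (\<lambda>(i, j). M (g i) (g j))"
    by (rule eq_matI)
      (auto simp: R_def A12_def A22_def scalar_prod_def R_sum s)
  have carr: "A11 \<in> carrier_mat ?a ?a" "A12 \<in> carrier_mat ?a ?c" "A22 \<in> carrier_mat ?c ?c"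
      "R \<in> carrier_mat ?c ?a"
    by (simp_all add: A11_def A12_def A22_def R_def)
  let ?L = "four_block_mat (1\<^sub>m ?a) (0\<^sub>m ?a ?c) R (1\<^sub>m ?c)"
  let ?U = "four_block_mat A11 A12 (0\<^sub>m ?c ?a) A22"
  have "mat (?a + ?c) (?a + ?c) (\<lambda>(i, j). M (e i) (e j)) =
      four_block_mat A11 A12 (mat ?c ?a (\<lambda>(i, j). M (g i) (f j)))
        (mat ?c ?c (\<lambda>(i, j). M (g i) (g j)))"
    by (rule eq_matI) (auto simp: A11_def A12_def e_def)
  also have "\<dots> = ?L * ?U"
    using carr
    by (subst mult_four_block_mat[where ?nr1.0 = ?a and ?n1.0 = ?a and ?n2.0 = ?c and ?nr2.0 = ?c
          and ?nc1.0 = ?a and ?nc2.0 = ?c])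
       (auto simp: R1 R2)
  finally have "det_on (A \<union> C) M = det (?L * ?U)"
    by (simp add: det_on_eq[OF e])
  also have "\<dots> = det ?L * det ?U"
    using carr by (intro det_mult[of _ "?a + ?c"]) auto
  also have "det ?L = 1"
    using carr by (subst det_four_block_mat_upper_right_zero[of _ ?a _ ?c]) auto
  also have "det ?U = det A11 * det A22"
    using carr by (intro det_four_block_mat_lower_left_zero[of _ ?a _ ?c]) auto
  finally show ?thesis
    by (simp add: det_on_eq[OF f] det_on_eq[OF g] A11_def A22_def)
qed

lemma det_on_2:
  assumes "x \<noteq> y"
  shows "det_on {x, y} M = M x x * M y y - M x y * M y x"
proof -
  define e where "e i = (if i = 0 then x else y)" for i :: nat
  have "bij_betw e {..<2} {x, y}"
    using assms by (auto simp: bij_betw_def e_def inj_on_def lessThan_Suc numeral_2_eq_2)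
  note E = det_on_eq[OF this, of M]
  have I: "{0..<2} = insert 0 {1 :: nat}" by auto
  have f: "finite {1 :: nat}" "0 \<notin> {1 :: nat}" by auto
  show ?thesis
    unfolding E det_def'[OF mat_carrier] unfolding I sum_over_permutations_insert[OF f] permutes_sing
    by (simp add: e_def sign_swap_id permutation_swap_id sign_compose sign_id transpose_def)
qed

lemma det_on_3:
  assumes "x \<noteq> y" "x \<noteq> z" "y \<noteq> z"
  shows "det_on {x, y, z} M =
    M x x * M y y * M z z + M x y * M y z * M z x + M x z * M y x * M z y
    - M x x * M y z * M z y - M x y * M y x * M z z - M x z * M y y * M z x"
proof -
  define e where "e i = (if i = 0 then x else if i = 1 then y else z)" for i :: nat
  have "bij_betw e {..<3} {x, y, z}"
    using assms by (auto simp: bij_betw_def e_def inj_on_def lessThan_Suc numeral_3_eq_3)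
  note E = det_on_eq[OF this, of M]
  have I: "{0..<3} = insert 0 (insert 1 {2 :: nat})" by auto
  have f: "finite {1, 2 :: nat}" "0 \<notin> {1, 2 :: nat}" "finite {2 :: nat}" "1 \<notin> {2 :: nat}" by auto
  show ?thesis
    unfolding E det_def'[OF mat_carrier]
    unfolding I sum_over_permutations_insert[OF f(1,2)] sum_over_permutations_insert[OF f(3,4)]
      permutes_sing
    by (simp add: e_def sign_swap_id permutation_swap_id sign_compose sign_id transpose_def)
qed

section \<open>Paths in trees\<close>

text \<open>The set of edges of a walk by recursion on its list of vertices, which suits splitting and
  reversing the list better than the description by positions.\<close>

fun walk_edges :: "'a list \<Rightarrow> 'a set set" where
  "walk_edges (x # y # p) = insert {x, y} (walk_edges (y # p))"
| "walk_edges _ = {}"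

lemma walk_edges_nth: "walk_edges p = {{p ! k, p ! Suc k} | k. Suc k < length p}"
proof (induction p rule: walk_edges.induct)
  case (1 x y p)
  have "{{(x # y # p) ! k, (x # y # p) ! Suc k} | k. Suc k < length (x # y # p)} =
      insert {x, y} {{(y # p) ! k, (y # p) ! Suc k} | k. Suc k < length (y # p)}"
    (is "?L = ?R")
  proof
    show "?L \<subseteq> ?R"
    proof
      fix e assume "e \<in> ?L"
      then obtain k where k: "e = {(x # y # p) ! k, (x # y # p) ! Suc k}"
          "Suc k < length (x # y # p)"
        by blast
      show "e \<in> ?R"
      proof (cases k)
        case 0
        then show ?thesis using k by simp
      next
        case (Suc j)
        then have "e = {(y # p) ! j, (y # p) ! Suc j}" "Suc j < length (y # p)"
          using k by auto
        then show ?thesis by blast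
      qed
    qed
    have "{x, y} \<in> ?L"
      by (rule CollectI, rule exI[of _ 0]) simp
    moreover have "{(y # p) ! k, (y # p) ! Suc k} \<in> ?L" if "Suc k < length (y # p)" for k
      using that by (intro CollectI exI[of _ "Suc k"]) simp
    ultimately show "?R \<subseteq> ?L" by blast
  qed
  then show ?case by (simp add: 1)
qed auto

lemma walk_edges_append: "walk_edges (p @ z # r) = walk_edges (p @ [z]) \<union> walk_edges (z # r)"
  by (induction p rule: walk_edges.induct) auto

lemma walk_edges_rev: "walk_edges (rev p) = walk_edges p"
  by (induction p rule: walk_edges.induct)
    (auto simp: walk_edges_append[of _ _ "[_]"] insert_commute)

lemma walk_edges_snoc: "p \<noteq> [] \<Longrightarrow> walk_edges (p @ [w]) = insert {last p, w} (walk_edges p)"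
  by (induction p rule: walk_edges.induct) auto

lemma path_edges_eq: "path_edges V E u v = walk_edges (tree_path V E u v)"
  by (simp add: path_edges_def walk_edges_nth Let_def)

text \<open>Two different paths with common ends have a first point of divergence. After it, the first path
  meets the second one again; the two pieces between divergence and the first such meeting form
  a cycle.\<close>

lemma is_path_unique:
  assumes acyclic: "\<nexists>p. is_cycle V E p" and "is_path V E u p v" and "is_path V E u r v"
  shows "p = r"
  using assms(2,3)
proof (induction p arbitrary: u r)
  case Nil
  then show ?case by (simp add: is_path_def)
next
  case (Cons x p)
  then have x: "x = u" by (simp add: is_path_def)
  obtain q' where r: "r = u # q'"
    using Cons.prems(2) by (cases r) (auto simp: is_path_def)
  show ?case
  proof (cases "p = [] \<or> q' = []")
    case True
    then show ?thesis
      using Cons.prems x r by (auto simp: is_path_def split: if_splits)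
  next
    case False
    then have ne: "p \<noteq> []" "q' \<noteq> []" by auto
    have p_path: "is_path V E (hd p) p v" and q_path: "is_path V E (hd q') q' v"
      and u: "u \<notin> set p" "u \<notin> set q'" "u \<in> V" "{u, hd p} \<in> E" "{u, hd q'} \<in> E"
      using Cons.prems ne x r by (auto simp: is_path_def successively_Cons)
    have "hd p = hd q'"
    proof (rule ccontr)
      assume neq: "hd p \<noteq> hd q'"
      have "v \<in> set p" "v \<in> set q'"
        using p_path q_path unfolding is_path_def by (metis last_in_set)+
      then obtain a z b where p: "p = a @ z # b" "z \<in> set q'" "\<forall>w\<in>set a. w \<notin> set q'"
        using split_list_first_prop[of p "\<lambda>w. w \<in> set q'"] by blast
      obtain a' b' where q': "q' = a' @ z # b'"
        using split_list[OF p(2)] by blast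
      have "is_cycle V E (u # a @ z # rev a')"
        unfolding is_cycle_def
      proof (intro conjI)
        show "3 \<le> length (u # a @ z # rev a')"
          using neq p(1) q' by (cases a; cases a') auto
        show "set (u # a @ z # rev a') \<subseteq> V"
          using p_path q_path u(3) p(1) q' by (auto simp: is_path_def)
        show "distinct (u # a @ z # rev a')"
          using p_path q_path u p q' by (auto simp: is_path_def)
        have "successively (\<lambda>x y. {x, y} \<in> E) (a @ [z])"
          using p_path p(1) by (auto simp: is_path_def successively_append_iff)
        moreover have "successively (\<lambda>x y. {x, y} \<in> E) (rev (a' @ [z]))"
          using q_path q' unfolding successively_rev
          by (auto simp: is_path_def successively_append_iff insert_commute)
        moreover have "{u, hd (a @ [z])} \<in> E"
          using u(4) p(1) by (cases a) auto
        ultimately show "successively (\<lambda>x y. {x, y} \<in> E) (u # a @ z # rev a')"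
          by (auto simp: successively_append_iff successively_Cons hd_append)
        have "last (z # rev a') = hd q'"
          using q' by (cases a') auto
        then show "{last (u # a @ z # rev a'), hd (u # a @ z # rev a')} \<in> E"
          using u(5) by (simp add: insert_commute)
      qed
      then show False using acyclic by blast
    qed
    then show ?thesis
      using Cons.IH[OF p_path] q_path x r by simp
  qed
qed

section \<open>Rooted trees\<close>

locale rooted_tree =
  fixes V :: "'a set" and E :: "'a set set" and c :: 'a
  assumes tree: "is_tree V E" and root: "c \<in> V"
begin

lemma finite_V: "finite V"
  using tree by (simp add: is_tree_def simple_graph_def)

lemma edgeD:
  assumes "{x, y} \<in> E"
  shows "x \<in> V" "y \<in> V" "x \<noteq> y"
proof -
  have "{x, y} \<subseteq> V" "card {x, y} = 2"
    using assms tree by (auto simp: is_tree_def simple_graph_def)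
  then show "x \<in> V" "y \<in> V" "x \<noteq> y" by auto
qed

lemma tree_path_eqI: "is_path V E u p v \<Longrightarrow> tree_path V E u v = p"
  unfolding tree_path_def
proof (rule the_equality)
  fix r assume "is_path V E u p v" "is_path V E u r v"
  then show "r = p"
    using tree is_path_unique unfolding is_tree_def by metis
qed

text \<open>The path from the root to a vertex. All relations of the rooted tree are read off from these
  lists: ancestors are their elements, the parent is the last element but one.\<close>

definition branch :: "'a \<Rightarrow> 'a list" where
  "branch v = tree_path V E c v"

lemma branch_eqI: "is_path V E c p v \<Longrightarrow> branch v = p"
  by (simp add: branch_def tree_path_eqI)

lemma branch_path:
  assumes "v \<in> V"
  shows "is_path V E c (branch v) v"
proof -
  obtain p where "is_path V E c p v"
    using assms tree root unfolding is_tree_def by blast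
  then show ?thesis using branch_eqI by simp
qed

lemma branch_props:
  assumes "v \<in> V"
  shows "branch v \<noteq> []" "set (branch v) \<subseteq> V" "distinct (branch v)"
    "successively (\<lambda>x y. {x, y} \<in> E) (branch v)" "hd (branch v) = c" "last (branch v) = v"
  using branch_path[OF assms] by (auto simp: is_path_def)

lemma branch_root: "branch c = [c]"
  using root by (intro branch_eqI) (simp add: is_path_def)

lemma branch_prefix:
  assumes "v \<in> V" and "branch v = a @ x # b"
  shows "branch x = a @ [x]"
proof (rule branch_eqI)
  show "is_path V E c (a @ [x]) x"
    using branch_props[OF assms(1)] unfolding assms(2)
    by (auto simp: is_path_def successively_append_iff hd_append split: if_splits)
qed

definition anc :: "'a \<Rightarrow> 'a \<Rightarrow> bool" where
  "anc x v \<longleftrightarrow> x \<in> set (branch v)"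

lemma anc_refl: "v \<in> V \<Longrightarrow> anc v v"
  using branch_props(1,6)[of v] last_in_set[of "branch v"] by (auto simp: anc_def)

lemma anc_in_V: "anc x v \<Longrightarrow> v \<in> V \<Longrightarrow> x \<in> V"
  using branch_props(2) by (auto simp: anc_def)

lemma anc_branchE:
  assumes "anc x v" "v \<in> V"
  obtains b where "branch v = branch x @ b"
proof -
  obtain a b where ab: "branch v = a @ x # b"
    using assms(1) split_list unfolding anc_def by fastforce
  then have "branch v = branch x @ b"
    using branch_prefix[OF assms(2) ab] by simp
  then show ?thesis by (rule that)
qed

lemma anc_trans: "anc x y \<Longrightarrow> anc y v \<Longrightarrow> v \<in> V \<Longrightarrow> anc x v"
  by (erule (1) anc_branchE[of y]) (auto simp: anc_def)

lemma anc_same_length: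
  assumes "anc x v" "v \<in> V" "length (branch v) \<le> length (branch x)"
  shows "x = v"
proof -
  obtain b where "branch v = branch x @ b"
    using anc_branchE[OF assms(1,2)] .
  then have "branch v = branch x" using assms(3) by simp
  then show ?thesis
    using branch_props(6)[of v] branch_props(6)[of x] anc_in_V assms by metis
qed

text \<open>The branches of two ancestors of a vertex are both prefixes of the branch of this vertex, so one
  of them is a prefix of the other.\<close>

lemma anc_linear:
  assumes "anc x v" "anc y v" "v \<in> V"
  shows "anc x y \<or> anc y x"
proof -
  have V: "x \<in> V" "y \<in> V" using assms anc_in_V by auto
  obtain b b' where b: "branch v = branch x @ b" "branch v = branch y @ b'"
    using anc_branchE assms by metis
  then have "branch x @ b = branch y @ b'" by simp
  then consider d where "branch x = branch y @ d" | d where "branch y = branch x @ d"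
    by (metis append_eq_append_conv2)
  then show ?thesis
    using anc_refl[OF V(1)] anc_refl[OF V(2)] by cases (auto simp: anc_def)
qed

definition par :: "'a \<Rightarrow> 'a" where
  "par v = last (butlast (branch v))"

lemma par:
  assumes "v \<in> V" "v \<noteq> c"
  shows "par v \<in> V" "branch v = branch (par v) @ [v]" "{par v, v} \<in> E"
proof -
  have v: "branch v = butlast (branch v) @ [v]"
    using branch_props(1,6)[OF assms(1)] append_butlast_last_id by metis
  have ne: "butlast (branch v) \<noteq> []"
    using v branch_props(5)[OF assms(1)] assms(2) by (cases "butlast (branch v)") auto
  then obtain a where a: "butlast (branch v) = a @ [par v]"
    using append_butlast_last_id unfolding par_def by metis
  then have av: "branch v = a @ par v # [v]" using v by simp
  show "par v \<in> V" using branch_props(2)[OF assms(1)] av by simp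
  show "branch v = branch (par v) @ [v]"
    using branch_prefix[OF assms(1) av] av by simp
  show "{par v, v} \<in> E"
    using branch_props(4)[OF assms(1)] unfolding av by (simp add: successively_append_iff)
qed

lemma parI:
  assumes "v \<in> V" "branch v = a @ x # v # b"
  shows "par v = x" "v \<noteq> c"
proof -
  have "branch v = (a @ [x]) @ [v]"
    using branch_prefix[OF assms(1), of "a @ [x]" v b] assms(2) by simp
  then show "par v = x" by (simp add: par_def butlast_append)
  show "v \<noteq> c" using \<open>branch v = (a @ [x]) @ [v]\<close> branch_root by auto
qed

lemma par_neq: "v \<in> V \<Longrightarrow> v \<noteq> c \<Longrightarrow> par v \<noteq> v"
  using par(2)[of v] by auto

lemma anc_par_iff: "v \<in> V \<Longrightarrow> v \<noteq> c \<Longrightarrow> anc x v \<longleftrightarrow> x = v \<or> anc x (par v)"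
  using par(2)[of v] by (auto simp: anc_def)

lemma not_anc_par: "v \<in> V \<Longrightarrow> v \<noteq> c \<Longrightarrow> \<not> anc v (par v)"
  using par(2)[of v] branch_props(3)[of v] by (auto simp: anc_def)

lemma length_branch_par: "v \<in> V \<Longrightarrow> v \<noteq> c \<Longrightarrow> length (branch v) = Suc (length (branch (par v)))"
  using par(2)[of v] by simp

definition parent_edge :: "'a \<Rightarrow> 'a set" where
  "parent_edge v = {par v, v}"

text \<open>If \<open>y\<close> is not on the branch of \<open>x\<close>, appending it gives the branch of \<open>y\<close>. Otherwise the final
  piece of the branch of \<open>x\<close> and the single edge are two paths from \<open>y\<close> to \<open>x\<close>, hence equal.\<close>

lemma edge_cases:
  assumes "{x, y} \<in> E"
  shows "y \<noteq> c \<and> par y = x \<or> x \<noteq> c \<and> par x = y"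
proof (cases "anc y x")
  case False
  have "is_path V E c (branch x @ [y]) y"
    using False edgeD[OF assms] branch_props[of x] assms
    by (auto simp: is_path_def anc_def successively_append_iff)
  then have b: "branch y = branch x @ [y]" by (rule branch_eqI)
  then have "branch y = butlast (branch x) @ x # y # []"
    using branch_props(1,6)[of x] edgeD(1)[OF assms] append_butlast_last_id[of "branch x"] by simp
  then show ?thesis using parI edgeD(2)[OF assms] by blast
next
  case True
  have V: "x \<in> V" "y \<in> V" "x \<noteq> y" using edgeD[OF assms] .
  obtain a b where ab: "branch x = a @ y # b"
    using True split_list unfolding anc_def by fastforce
  have "b \<noteq> []"
    using ab branch_props(6)[OF V(1)] V(3) by auto
  then have "is_path V E y (y # b) x"
    using branch_props[OF V(1)] unfolding ab
    by (auto simp: is_path_def successively_append_iff)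
  moreover have "is_path V E y [y, x] x"
    using V assms by (simp add: is_path_def insert_commute)
  ultimately have "b = [x]"
    using tree_path_eqI[of y "y # b" x] tree_path_eqI[of y "[y, x]" x] by simp
  then show ?thesis using parI[OF V(1)] ab by blast
qed

text \<open>Every edge joins a vertex to its parent, so the edges can be indexed by their lower ends. Two
  different vertices with the same edge would be each other's parents, which their distances from
  the root exclude.\<close>

lemma parent_edge_bij: "bij_betw parent_edge (V - {c}) E"
proof (rule bij_betw_imageI)
  show "inj_on parent_edge (V - {c})"
  proof (rule inj_onI, rule ccontr)
    fix x y assume x: "x \<in> V - {c}" and y: "y \<in> V - {c}" and "parent_edge x = parent_edge y" and "x \<noteq> y"
    then have "par x = y" "par y = x"
      by (auto simp: parent_edge_def doubleton_eq_iff)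
    then show False
      using length_branch_par[of x] length_branch_par[of y] x y by simp
  qed
  show "parent_edge ` (V - {c}) = E"
  proof
    show "parent_edge ` (V - {c}) \<subseteq> E" using par(3) by (auto simp: parent_edge_def)
    show "E \<subseteq> parent_edge ` (V - {c})"
    proof
      fix e assume e: "e \<in> E"
      then have "card e = 2" using tree by (auto simp: is_tree_def simple_graph_def)
      then obtain x y where xy: "e = {x, y}" by (auto simp: card_2_iff)
      have V: "x \<in> V" "y \<in> V" using edgeD e xy by auto
      from edge_cases[of x y] e xy have "y \<noteq> c \<and> e = parent_edge y \<or> x \<noteq> c \<and> e = parent_edge x"
        by (auto simp: parent_edge_def)
      then show "e \<in> parent_edge ` (V - {c})" using V by auto
    qed
  qed
qed

lemma parent_edge_inj: "A \<subseteq> V - {c} \<Longrightarrow> inj_on parent_edge A"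
  using inj_on_subset bij_betw_imp_inj_on[OF parent_edge_bij] by blast

lemma parent_edge_eq_iff: "x \<in> V - {c} \<Longrightarrow> y \<in> V - {c} \<Longrightarrow> parent_edge x = parent_edge y \<longleftrightarrow> x = y"
  using parent_edge_bij by (auto simp: bij_betw_def dest: inj_onD)

lemma walk_edges_branch:
  assumes "v \<in> V" "branch v = a @ z # b"
  shows "walk_edges (z # b) = parent_edge ` set b"
  using assms
proof (induction b arbitrary: v rule: rev_induct)
  case (snoc w b)
  have w: "branch w = a @ z # b @ [w]" "w \<in> V"
    using branch_prefix[OF snoc.prems(1), of "a @ z # b" w "[]"] snoc.prems branch_props(2)
    by fastforce+
  obtain b' x where x: "z # b = b' @ [x]"
    by (cases "z # b" rule: rev_cases) auto
  have "branch x = a @ z # b"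
    using branch_prefix[OF w(2), of "a @ b'" x "[w]"] w(1) x by simp
  moreover have "x \<in> V"
    using w x branch_props(2)[OF w(2)] by auto (metis in_set_conv_decomp set_ConsD subsetD x)
  ultimately have "walk_edges (z # b) = parent_edge ` set b"
    by (rule snoc.IH[rotated])
  moreover have "par w = x"
    using parI(1)[OF w(2), of "a @ b'" x "[]"] w(1) x by simp
  ultimately show ?case
    using walk_edges_snoc[of "z # b" w] last_snoc[of b' x] unfolding x[symmetric]
    by (simp add: parent_edge_def del: walk_edges.simps last.simps)
qed simp

text \<open>The branches of \<open>u\<close> and \<open>v\<close> share an initial piece and are disjoint after it. The path from \<open>u\<close>
  to \<open>v\<close> goes up the first remainder and down the second one, so its edges are those that lie on
  exactly one of the two branches.\<close>

lemma path_edges_iff: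
  assumes u: "u \<in> V" and v: "v \<in> V" and x: "x \<in> V - {c}"
  shows "parent_edge x \<in> path_edges V E u v \<longleftrightarrow> anc x u \<noteq> anc x v"
proof -
  obtain p us vs where p: "branch u = p @ us" "branch v = p @ vs"
    and split: "us = [] \<or> vs = [] \<or> hd us \<noteq> hd vs"
    using longest_common_prefix[of "branch u" "branch v"] by (metis list.sel(1) neq_Nil_conv)
  have "p \<noteq> []"
  proof
    assume "p = []"
    then have "us \<noteq> []" "vs \<noteq> []" "hd us = hd vs"
      using p branch_props(1,5)[OF u] branch_props(1,5)[OF v] by auto
    then show False using split by blast
  qed
  then obtain a z where a: "p = a @ [z]" by (cases p rule: rev_cases) auto
  have bu: "branch u = a @ z # us" and bv: "branch v = a @ z # vs"
    using p a by auto
  \<comment> \<open>By uniqueness of branches, a common vertex of the remainders would make them start equally.\<close>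
  have disj: "set us \<inter> set vs = {}"
  proof (rule ccontr)
    assume "set us \<inter> set vs \<noteq> {}"
    then obtain w where "w \<in> set us" "w \<in> set vs" by blast
    then obtain u1 u2 v1 v2 where uv: "us = u1 @ w # u2" "vs = v1 @ w # v2"
      by (meson split_list)
    have "p @ u1 @ [w] = p @ v1 @ [w]"
      using branch_prefix[OF u, of "p @ u1" w u2] branch_prefix[OF v, of "p @ v1" w v2] p uv
      by simp
    then have "u1 = v1" by simp
    then have "hd us = hd vs" using uv by (cases u1) auto
    then show False using split uv by auto
  qed
  have su: "successively (\<lambda>x y. {x, y} \<in> E) (z # us)"
    and sv: "successively (\<lambda>x y. {x, y} \<in> E) (z # vs)"
    using branch_props(4)[OF u] branch_props(4)[OF v] bu bv by (auto simp: successively_append_iff)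
  have "successively (\<lambda>x y. {x, y} \<in> E) (rev (z # us))"
    using su unfolding successively_rev by (simp add: insert_commute)
  then have "is_path V E u (rev us @ z # vs) v"
    using branch_props[OF u] branch_props[OF v] sv disj unfolding bu bv
    by (auto simp: is_path_def successively_append_iff successively_Cons hd_append hd_rev
        split: if_splits)
  then have "path_edges V E u v = walk_edges (rev us @ z # vs)"
    by (simp add: path_edges_eq tree_path_eqI)
  also have "\<dots> = walk_edges (rev (z # us)) \<union> walk_edges (z # vs)"
    by (subst walk_edges_append) simp
  also have "\<dots> = parent_edge ` (set us \<union> set vs)"
    using walk_edges_branch[OF u bu] walk_edges_branch[OF v bv]
    by (simp only: walk_edges_rev image_Un)
  finally have pe: "path_edges V E u v = parent_edge ` (set us \<union> set vs)" .
  have "set us \<union> set vs \<subseteq> V - {c}"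
  proof
    fix w assume w: "w \<in> set us \<union> set vs"
    have "c \<in> set p"
      using branch_props(5)[OF u] p(1) \<open>p \<noteq> []\<close> by (cases p) auto
    then show "w \<in> V - {c}"
      using w branch_props(2,3)[OF u] branch_props(2,3)[OF v] unfolding p by auto
  qed
  then have "parent_edge x \<in> path_edges V E u v \<longleftrightarrow> x \<in> set us \<union> set vs"
    unfolding pe using x parent_edge_eq_iff by blast
  also have "\<dots> \<longleftrightarrow> anc x u \<noteq> anc x v"
    using branch_props(3)[OF u] branch_props(3)[OF v] disj unfolding anc_def p by auto
  finally show ?thesis .
qed

lemma path_edges_root:
  assumes "v \<in> V"
  shows "path_edges V E c v = parent_edge ` (set (branch v) - {c})"
proof -
  obtain b where b: "branch v = [] @ c # b"
    using branch_props(1,5)[OF assms] by (cases "branch v") auto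
  have "set (branch v) - {c} = set b"
    using branch_props(3)[OF assms] b by auto
  then show ?thesis
    using walk_edges_branch[OF assms b] b by (simp add: path_edges_eq flip: branch_def)
qed

lemma card_path_edges_root:
  assumes "v \<in> V"
  shows "Suc (card (path_edges V E c v)) = length (branch v)"
proof -
  have "inj_on parent_edge (set (branch v) - {c})"
    using branch_props(2)[OF assms] by (intro parent_edge_inj) blast
  moreover have "c \<in> set (branch v)"
    using branch_props(1,5)[OF assms] hd_in_set by metis
  ultimately show ?thesis
    using path_edges_root[OF assms] branch_props(3)[OF assms]
    by (simp add: card_image distinct_card card.remove[symmetric] del: card_Diff_insert)
qed

lemma level_parent_edge:
  assumes "v \<in> V" "v \<noteq> c"
  shows "level V E c (parent_edge v) = length (branch (par v)) - 1"
proof -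
  have "card (path_edges V E c v) = Suc (card (path_edges V E c (par v)))"
    using card_path_edges_root[OF assms(1)] card_path_edges_root[OF par(1)[OF assms]]
      length_branch_par[OF assms] by simp
  then show ?thesis
    using card_path_edges_root[OF par(1)[OF assms]] by (simp add: level_def parent_edge_def)
qed

definition children :: "'a \<Rightarrow> 'a set" where
  "children u = {w \<in> V - {c}. par w = u}"

lemma childrenD: "w \<in> children u \<Longrightarrow> w \<in> V \<and> w \<noteq> c \<and> par w = u"
  by (simp add: children_def)

lemma finite_children: "finite (children u)"
  using finite_V by (simp add: children_def)

lemma children_disjoint: "u \<noteq> w \<Longrightarrow> children u \<inter> children w = {}"
  by (auto simp: children_def)

lemma vdegree_eq:
  assumes "u \<in> V"
  shows "vdegree E u = card (children u) + (if u = c then 0 else 1)"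
proof -
  let ?A = "children u \<union> (if u = c then {} else {u})"
  have "{e \<in> E. u \<in> e} = {e \<in> parent_edge ` (V - {c}). u \<in> e}"
    using parent_edge_bij by (simp add: bij_betw_def)
  also have "\<dots> = parent_edge ` {x \<in> V - {c}. u \<in> parent_edge x}"
    by auto
  also have "{x \<in> V - {c}. u \<in> parent_edge x} = ?A"
    using assms by (auto simp: children_def parent_edge_def)
  also have "card (parent_edge ` ?A) = card ?A"
    using assms by (intro card_image parent_edge_inj) (auto simp: children_def)
  also have "\<dots> = card (children u) + (if u = c then 0 else 1)"
    using finite_children par_neq[OF assms] by (auto simp: children_def)
  finally show ?thesis by (simp add: vdegree_def)
qed

text \<open>The child in question is the successor of \<open>u\<close> on the branch of \<open>v\<close>.\<close>

lemma anc_imp_child: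
  assumes "anc u v" "v \<in> V" "u \<noteq> v"
  shows "\<exists>w\<in>children u. anc w v"
proof -
  obtain a b where ab: "branch v = a @ u # b"
    using assms(1) split_list unfolding anc_def by fastforce
  moreover have "b \<noteq> []" using ab branch_props(6)[OF assms(2)] assms(3) by auto
  ultimately obtain w b' where w: "branch v = a @ u # w # b'" by (cases b) auto
  then have "branch w = a @ u # w # []" "w \<in> V"
    using branch_prefix[OF assms(2), of "a @ [u]" w b'] branch_props(2)[OF assms(2)] by auto
  then have "w \<in> children u" using parI by (auto simp: children_def)
  moreover have "anc w v" using w by (simp add: anc_def)
  ultimately show ?thesis by blast
qed

lemma siblings_not_anc:
  assumes "w \<in> children u" "w' \<in> children u" "w \<noteq> w'"
  shows "\<not> anc w w'"
proof
  assume "anc w w'"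
  moreover have "length (branch w') = length (branch w)"
    using length_branch_par childrenD assms by metis
  ultimately have "w = w'"
    using anc_same_length childrenD[OF assms(2)] by simp
  then show False using assms(3) by simp
qed

definition leaves_below :: "'a \<Rightarrow> 'a set" where
  "leaves_below x = {v \<in> boundary V E. anc x v}"

lemma boundary_in_V: "v \<in> boundary V E \<Longrightarrow> v \<in> V"
  by (simp add: boundary_def)

lemma finite_boundary: "finite (boundary V E)"
  using finite_V by (simp add: boundary_def)

lemma finite_leaves_below: "finite (leaves_below x)"
  using finite_boundary by (simp add: leaves_below_def)

lemma n_beyond_parent_edge:
  assumes "x \<in> V - {c}"
  shows "n_beyond V E c (parent_edge x) = card (leaves_below x)"
proof -
  have "\<not> anc x c" using assms by (simp add: anc_def branch_root)
  then have "parent_edge x \<in> path_edges V E c v \<longleftrightarrow> anc x v" if "v \<in> V" for v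
    using path_edges_iff[OF root that assms] by simp
  then show ?thesis
    by (auto simp: n_beyond_def leaves_below_def dest: boundary_in_V intro!: arg_cong[of _ _ card])
qed

lemma siblings_leaves_disjoint:
  assumes "w \<in> children u" "w' \<in> children u" "w \<noteq> w'"
  shows "leaves_below w \<inter> leaves_below w' = {}"
  using siblings_not_anc[OF assms] siblings_not_anc[OF assms(2,1)] assms(3) anc_linear boundary_in_V
  by (fastforce simp: leaves_below_def)

lemma leaves_below_subset:
  assumes "anc x y"
  shows "leaves_below y \<subseteq> leaves_below x"
  using assms anc_trans boundary_in_V by (auto simp: leaves_below_def)

lemma leaves_below_children:
  assumes "u \<in> V" "u \<notin> boundary V E"
  shows "leaves_below u = (\<Union>w\<in>children u. leaves_below w)"
proof
  show "leaves_below u \<subseteq> (\<Union>w\<in>children u. leaves_below w)"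
  proof
    fix v assume v: "v \<in> leaves_below u"
    then have "v \<noteq> u" using assms by (auto simp: leaves_below_def)
    with v anc_imp_child[of u v] boundary_in_V
    show "v \<in> (\<Union>w\<in>children u. leaves_below w)"
      by (auto simp: leaves_below_def)
  qed
  show "(\<Union>w\<in>children u. leaves_below w) \<subseteq> leaves_below u"
  proof (rule UN_least)
    fix w assume "w \<in> children u"
    then have "anc u w"
      using childrenD[of w u] anc_par_iff[of w u] anc_refl[OF assms(1)] by simp
    then show "leaves_below w \<subseteq> leaves_below u" by (rule leaves_below_subset)
  qed
qed

lemma card_leaves_below_children:
  assumes "u \<in> V" "u \<notin> boundary V E"
  shows "card (leaves_below u) = (\<Sum>w\<in>children u. card (leaves_below w))"
  unfolding leaves_below_children[OF assms]
  using finite_children finite_leaves_below siblings_leaves_disjoint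
  by (intro card_UN_disjoint) auto

lemma leaves_below_root: "leaves_below c = boundary V E"
proof -
  have "anc c v" if "v \<in> V" for v
    using branch_props(1,5)[OF that] hd_in_set by (metis anc_def)
  then show ?thesis using boundary_in_V by (auto simp: leaves_below_def)
qed

end

section \<open>Leaf counts in rooted binary trees\<close>

locale rooted_binary_tree = rooted_tree +
  assumes degrees: "\<forall>v\<in>V. vdegree E v = 1 \<or> vdegree E v = 3"
    and root_degree: "vdegree E c = 3"
begin

text \<open>The root is left out: each remaining vertex with children has exactly two of them and also an
  edge to its parent, and the sibling pairs in the determinant formula are the pairs of children
  of these vertices.\<close>

definition inner :: "'a set" where
  "inner = V - {c} - boundary V E"

lemma finite_inner: "finite inner"
  using finite_V by (simp add: inner_def)

lemma root_not_boundary: "c \<notin> boundary V E"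
  by (simp add: boundary_def root_degree)

lemma card_children_root: "card (children c) = 3"
  using vdegree_eq[OF root] root_degree by simp

lemma card_children_inner: "u \<in> inner \<Longrightarrow> card (children u) = 2"
  using vdegree_eq[of u] degrees by (auto simp: inner_def boundary_def)

lemma children_boundary:
  assumes "u \<in> boundary V E"
  shows "children u = {}"
proof -
  have "vdegree E u = 1" "u \<noteq> c"
    using assms root_not_boundary by (auto simp: boundary_def)
  then have "card (children u) = 0"
    using vdegree_eq[OF boundary_in_V[OF assms]] by simp
  then show ?thesis using finite_children by simp
qed

lemma children_inner_cases: "w \<in> V - {c} \<Longrightarrow> par w = c \<or> par w \<in> inner"
  using children_boundary[of "par w"] par(1)[of w] by (auto simp: inner_def children_def)

lemma card_inner: "card (V - {c}) = card (boundary V E) + card inner"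
proof -
  have "V - {c} = boundary V E \<union> inner" "boundary V E \<inter> inner = {}"
    using boundary_in_V root_not_boundary by (auto simp: inner_def)
  then show ?thesis
    using finite_boundary finite_inner by (metis card_Un_disjoint)
qed

text \<open>The index sets that occur in the elimination: for a set \<open>S\<close> of inner vertices that is closed under
  parents, these are the non-root vertices of the subtree obtained by expanding the root and the
  vertices of \<open>S\<close> only.\<close>

definition below :: "'a set \<Rightarrow> 'a set" where
  "below S = children c \<union> (\<Union>u\<in>S. children u)"

lemma below_inner: "below inner = V - {c}"
  using children_inner_cases by (auto simp: below_def children_def)

text \<open>Each vertex other than the root is counted once as a child: three times below the root and twice
  below every inner vertex. Comparing this with the partition into boundary and inner vertices
  eliminates the number of inner vertices.\<close>

lemma card_edges: "card (V - {c}) + 3 = 2 * card (boundary V E)"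
proof -
  have "card (below inner) = card (children c) + card (\<Union>u\<in>inner. children u)"
    unfolding below_def using finite_children finite_inner children_disjoint
    by (intro card_Un_disjoint) (auto simp: inner_def children_def)
  also have "card (\<Union>u\<in>inner. children u) = (\<Sum>u\<in>inner. card (children u))"
    using finite_children finite_inner children_disjoint
    by (intro card_UN_disjoint) auto
  also have "\<dots> = 2 * card inner"
    by (simp add: card_children_inner)
  finally have "card (V - {c}) = 3 + 2 * card inner"
    by (simp add: below_inner card_children_root)
  then show ?thesis using card_inner by simp
qed

text \<open>Induction on the distance from the greatest conceivable depth: a vertex that is not a leaf has
  a child, and the child is deeper.\<close>

lemma leaves_below_nonempty:
  assumes "x \<in> V"
  shows "leaves_below x \<noteq> {}"
  using assms
proof (induction "card V - length (branch x)" arbitrary: x rule: less_induct)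
  case less
  show ?case
  proof (cases "x \<in> boundary V E")
    case True
    then show ?thesis using anc_refl[OF less.prems] by (auto simp: leaves_below_def)
  next
    case False
    then have "children x \<noteq> {}"
      using card_children_root card_children_inner[of x] less.prems
      by (cases "x = c") (auto simp: inner_def)
    then obtain w where w: "w \<in> children x" by blast
    then have wV: "w \<in> V" "w \<noteq> c" "par w = x" using childrenD by auto
    have "length (branch w) \<le> card V"
      using branch_props(2,3)[OF wV(1)] finite_V by (metis card_mono distinct_card)
    then have "card V - length (branch w) < card V - length (branch x)"
      using length_branch_par[OF wV(1,2)] wV(3) by simp
    then have "leaves_below w \<noteq> {}" using less.hyps wV(1) by blast
    then show ?thesis
      using leaves_below_children[OF less.prems False] w by blast
  qed
qed

abbreviation leaf_number :: real where
  "leaf_number \<equiv> real (card (boundary V E))"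

definition beyond :: "'a \<Rightarrow> real" where
  "beyond x = real (card (leaves_below x))"

lemma beyond_pos: "x \<in> V \<Longrightarrow> beyond x > 0"
  using leaves_below_nonempty finite_leaves_below by (simp add: beyond_def card_gt_0_iff)

lemma beyond_root: "beyond c = leaf_number"
  by (simp add: beyond_def leaves_below_root)

lemma beyond_children: "u \<in> inner \<union> {c} \<Longrightarrow> beyond u = (\<Sum>w\<in>children u. beyond w)"
  using card_leaves_below_children[of u] root root_not_boundary
  by (auto simp: beyond_def inner_def)

text \<open>A non-root vertex has a sibling, and the leaves below the sibling are not below the vertex.\<close>

lemma beyond_less:
  assumes "x \<in> V - {c}"
  shows "beyond x < leaf_number"
proof -
  have x: "x \<in> children (par x)" using assms by (simp add: children_def)
  have "card (children (par x)) \<ge> 2"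
    using children_inner_cases[OF assms] card_children_root card_children_inner[of "par x"] by auto
  then have "children (par x) \<noteq> {x}" by auto
  then obtain y where y: "y \<in> children (par x)" "y \<noteq> x" using x by blast
  have "leaves_below x \<union> leaves_below y \<subseteq> boundary V E"
    by (auto simp: leaves_below_def)
  then have "card (leaves_below x \<union> leaves_below y) \<le> card (boundary V E)"
    using finite_boundary card_mono by blast
  moreover have "card (leaves_below x \<union> leaves_below y) =
      card (leaves_below x) + card (leaves_below y)"
    using siblings_leaves_disjoint[OF x y(1)] y(2) finite_leaves_below
    by (simp add: card_Un_disjoint)
  ultimately show ?thesis
    using beyond_pos[of y] childrenD[OF y(1)] by (simp add: beyond_def)
qed

end

section \<open>The entries of the matrix\<close>

lemma card_unordered_pairs:
  assumes "finite A" "finite B" "A \<inter> B = {}"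
  shows "card {{u, v} | u v. u \<in> A \<and> v \<in> B} = card A * card B"
proof -
  have "{{u, v} | u v. u \<in> A \<and> v \<in> B} = (\<lambda>(u, v). {u, v}) ` (A \<times> B)"
    by auto
  moreover have "inj_on (\<lambda>(u, v). {u, v}) (A \<times> B)"
    using assms(3) by (auto simp: inj_on_def doubleton_eq_iff)
  ultimately show ?thesis
    by (simp add: card_image card_cartesian_product)
qed

context rooted_binary_tree
begin

lemma pairs_through_parent_edges:
  assumes x: "x \<in> V - {c}" and y: "y \<in> V - {c}" and A: "A = leaves_below x" "B = leaves_below y"
  shows "pairs_through V E {parent_edge x, parent_edge y} =
    {{u, v} | u v. u \<in> boundary V E \<and> v \<in> boundary V E \<and>
       (u \<in> A) \<noteq> (v \<in> A) \<and> (u \<in> B) \<noteq> (v \<in> B)}"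
proof -
  have "u \<noteq> v \<and> {parent_edge x, parent_edge y} \<subseteq> path_edges V E u v \<longleftrightarrow>
      (u \<in> A) \<noteq> (v \<in> A) \<and> (u \<in> B) \<noteq> (v \<in> B)"
    if "u \<in> boundary V E" "v \<in> boundary V E" for u v
    using path_edges_iff[OF _ _ x, of u v] path_edges_iff[OF _ _ y, of u v] that boundary_in_V
    by (auto simp: A leaves_below_def)
  then show ?thesis
    unfolding pairs_through_def by (intro Collect_cong ex_cong1) (metis (no_types, lifting))
qed

text \<open>A pair that is separated by the lower edge has one end below it, hence below both edges; the other
  end then has to lie outside the larger of the two nested leaf sets.\<close>

lemma card_pairs_through_anc:
  assumes "x \<in> V - {c}" "y \<in> V - {c}" "anc x y"
  shows "real (card (pairs_through V E {parent_edge x, parent_edge y})) =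
    beyond y * (leaf_number - beyond x)"
proof -
  let ?A = "leaves_below x" and ?B = "leaves_below y"
  have BA: "?B \<subseteq> ?A" "?A \<subseteq> boundary V E"
    using leaves_below_subset[OF assms(3)] by (auto simp: leaves_below_def)
  have "pairs_through V E {parent_edge x, parent_edge y} =
      {{u, v} | u v. u \<in> ?B \<and> v \<in> boundary V E - ?A}" (is "?P = ?R")
  proof
    show "?P \<subseteq> ?R"
    proof
      fix p assume "p \<in> ?P"
      then obtain u v where "p = {u, v}" "u \<in> boundary V E" "v \<in> boundary V E"
        "(u \<in> ?A) \<noteq> (v \<in> ?A)" "(u \<in> ?B) \<noteq> (v \<in> ?B)"
        unfolding pairs_through_parent_edges[OF assms(1,2) refl refl] by blast
      then have "p = {u, v} \<and> u \<in> ?B \<and> v \<in> boundary V E - ?A \<or>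
          p = {v, u} \<and> v \<in> ?B \<and> u \<in> boundary V E - ?A"
        using BA by (auto simp: insert_commute)
      then show "p \<in> ?R" by blast
    qed
    show "?R \<subseteq> ?P"
      unfolding pairs_through_parent_edges[OF assms(1,2) refl refl] using BA by blast
  qed
  also have "card \<dots> = card ?B * card (boundary V E - ?A)"
    using finite_boundary finite_leaves_below BA by (intro card_unordered_pairs) auto
  also have "card (boundary V E - ?A) = card (boundary V E) - card ?A"
    using BA finite_leaves_below by (simp add: card_Diff_subset)
  finally show ?thesis
    using card_mono[OF finite_boundary BA(2)] by (simp add: beyond_def of_nat_diff)
qed

text \<open>For incomparable edges the leaf sets are disjoint, and a pair separated by both edges has one end
  in each of them.\<close>

lemma card_pairs_through_not_anc:
  assumes "x \<in> V - {c}" "y \<in> V - {c}" "\<not> anc x y" "\<not> anc y x"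
  shows "real (card (pairs_through V E {parent_edge x, parent_edge y})) = beyond x * beyond y"
proof -
  let ?A = "leaves_below x" and ?B = "leaves_below y"
  have AB: "?A \<inter> ?B = {}" "?A \<subseteq> boundary V E" "?B \<subseteq> boundary V E"
    using assms(3,4) anc_linear boundary_in_V by (auto simp: leaves_below_def)
  have "pairs_through V E {parent_edge x, parent_edge y} = {{u, v} | u v. u \<in> ?A \<and> v \<in> ?B}" (is "?P = ?R")
  proof
    show "?P \<subseteq> ?R"
    proof
      fix p assume "p \<in> ?P"
      then obtain u v where "p = {u, v}"
        "(u \<in> ?A) \<noteq> (v \<in> ?A)" "(u \<in> ?B) \<noteq> (v \<in> ?B)"
        unfolding pairs_through_parent_edges[OF assms(1,2) refl refl] by blast
      then have "p = {u, v} \<and> u \<in> ?A \<and> v \<in> ?B \<or> p = {v, u} \<and> v \<in> ?A \<and> u \<in> ?B"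
        using AB by (auto simp: insert_commute)
      then show "p \<in> ?R" by blast
    qed
    show "?R \<subseteq> ?P"
      unfolding pairs_through_parent_edges[OF assms(1,2) refl refl] using AB by blast
  qed
  also have "card \<dots> = card ?A * card ?B"
    using finite_leaves_below AB by (intro card_unordered_pairs) auto
  finally show ?thesis by (simp add: beyond_def)
qed

text \<open>After the row and the column of each \<open>x\<close> are multiplied by \<open>n - n(x)\<close>, the entry of \<open>Q\<close> at two
  comparable edges depends only on the upper one, and is \<open>n / n(x) - 1\<close> for this edge \<open>x\<close>. All
  other entries become \<open>1\<close>. This is the matrix \<open>scaled\<close>.\<close>

definition ratio :: "'a \<Rightarrow> real" where
  "ratio x = leaf_number / beyond x - 1"

definition scaled :: "'a \<Rightarrow> 'a \<Rightarrow> real" where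
  "scaled x y = (if anc x y then ratio x else if anc y x then ratio y else 1)"

lemma q_parent_edge:
  assumes "x \<in> V - {c}"
  shows "real (q V E (parent_edge x)) = beyond x * (leaf_number - beyond x)"
  using card_pairs_through_anc[OF assms assms] anc_refl assms by (simp add: q_def)

lemma Q_entry_parent_edge:
  assumes "x \<in> V - {c}" "y \<in> V - {c}"
  shows "Q_entry V E (parent_edge x) (parent_edge y) =
    1 / (leaf_number - beyond x) * scaled x y * (1 / (leaf_number - beyond y))"
proof -
  have pos: "beyond x \<noteq> 0" "beyond y \<noteq> 0" "leaf_number - beyond x \<noteq> 0" "leaf_number - beyond y \<noteq> 0"
    using beyond_pos[of x] beyond_pos[of y] beyond_less[of x] beyond_less[of y] assms by auto
  consider "anc x y" | "\<not> anc x y" "anc y x" | "\<not> anc x y" "\<not> anc y x" by blast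
  then show ?thesis
  proof cases
    case 1
    then show ?thesis
      using card_pairs_through_anc[OF assms] pos
      unfolding Q_entry_def q_parent_edge[OF assms(1)] q_parent_edge[OF assms(2)]
      by (simp add: scaled_def ratio_def divide_simps)
  next
    case 2
    then show ?thesis
      using card_pairs_through_anc[OF assms(2,1)] pos
      unfolding Q_entry_def q_parent_edge[OF assms(1)] q_parent_edge[OF assms(2)]
      by (simp add: scaled_def ratio_def divide_simps insert_commute)
  next
    case 3
    then show ?thesis
      using card_pairs_through_not_anc[OF assms] pos
      unfolding Q_entry_def q_parent_edge[OF assms(1)] q_parent_edge[OF assms(2)]
      by (simp add: scaled_def divide_simps)
  qed
qed

end

section \<open>Elimination of sibling pairs\<close>

context rooted_binary_tree
begin

lemma scaled_siblings:
  assumes "w \<in> children u" "w' \<in> children u"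
  shows "scaled w w' = (if w = w' then ratio w else 1)"
  using siblings_not_anc[OF assms] siblings_not_anc[OF assms(2,1)] anc_refl childrenD[OF assms(1)]
  by (auto simp: scaled_def)

lemma scaled_parent:
  assumes "w \<in> children u" "u \<in> inner"
  shows "scaled u w = ratio u"
  using anc_par_iff[of w u] childrenD[OF assms(1)] anc_refl[of u] assms(2)
  by (auto simp: scaled_def inner_def)

text \<open>With \<open>a\<close>, \<open>b\<close>, \<open>d\<close> leaves below the three children, the ratios are \<open>n/a - 1\<close>, \<open>n/b - 1\<close> and
  \<open>n/d - 1\<close>, and \<open>n = a + b + d\<close> makes all terms but a constant cancel.\<close>

lemma det_children_root: "det_on (children c) scaled = 4"
proof -
  obtain x y z where xyz: "children c = {x, y, z}" "x \<noteq> y" "x \<noteq> z" "y \<noteq> z"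
    using card_children_root by (auto simp: card_3_iff)
  define a where "a = beyond x"
  define b where "b = beyond y"
  define d where "d = beyond z"
  have pos: "a > 0" "b > 0" "d > 0"
    using beyond_pos xyz(1) childrenD[of _ c] unfolding a_def b_def d_def by blast+
  have sum: "leaf_number = a + b + d"
    using beyond_children[of c] xyz by (simp add: beyond_root a_def b_def d_def)
  have "det_on (children c) scaled =
      ratio x * ratio y * ratio z + 2 - ratio x - ratio y - ratio z"
    using xyz(2-4) scaled_siblings[of _ c] unfolding xyz(1) by (simp add: det_on_3)
  also have "\<dots> = 4"
    unfolding ratio_def sum using pos by (simp add: field_simps flip: a_def b_def d_def)
  finally show ?thesis .
qed

text \<open>The reciprocals of \<open>p = n / n(x)\<close> and \<open>r = n / n(y)\<close> add up to the reciprocal of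
  \<open>s = n / n(u)\<close>. Hence \<open>p r = s (p + r)\<close>, and in \<open>(p - s)(r - s) - (2 - s)\<^sup>2\<close> everything cancels
  except \<open>4 (s - 1)\<close>.\<close>

lemma det_children_inner:
  assumes "u \<in> inner"
  shows "det_on (children u) (\<lambda>x y. scaled x y - scaled u y) = 4 * ratio u"
proof -
  obtain x y where xy: "children u = {x, y}" "x \<noteq> y"
    using card_children_inner[OF assms] by (auto simp: card_2_iff)
  define p where "p = leaf_number / beyond x"
  define r where "r = leaf_number / beyond y"
  define s where "s = leaf_number / beyond u"
  have sum: "beyond u = beyond x + beyond y"
    using beyond_children[of u] assms xy by simp
  have pos: "beyond x > 0" "beyond y > 0"
    using beyond_pos xy(1) childrenD[of _ u] by blast+
  then have "p + r = leaf_number * (beyond x + beyond y) / (beyond x * beyond y)"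
    by (simp add: p_def r_def field_simps)
  moreover have "beyond x + beyond y \<noteq> 0" using pos by simp
  ultimately have additive: "p * r = s * (p + r)"
    by (simp add: p_def r_def s_def sum)
  have "det_on (children u) (\<lambda>x y. scaled x y - scaled u y) =
      (ratio x - ratio u) * (ratio y - ratio u) - (1 - ratio u) * (1 - ratio u)"
    using xy(2) scaled_siblings[of _ u] scaled_parent[OF _ assms] unfolding xy(1)
    by (simp add: det_on_2)
  also have "\<dots> = (p - s) * (r - s) - (2 - s) * (2 - s)"
    by (simp add: ratio_def p_def r_def s_def)
  also have "\<dots> = 4 * (s - 1)"
    using additive by (simp add: algebra_simps)
  finally show ?thesis by (simp add: ratio_def s_def)
qed

text \<open>Among the columns that are not strictly below \<open>u\<close>, a child of \<open>u\<close> has no descendants, and its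
  ancestors are those of \<open>u\<close> together with \<open>u\<close>. So both rows see the same upper edges there.\<close>

lemma scaled_rows_agree:
  assumes x: "x \<in> children u" and u: "u \<in> inner" and y: "y \<in> V" and "y = u \<or> \<not> anc u y"
  shows "scaled x y = scaled u y"
proof -
  have xV: "x \<in> V" "x \<noteq> c" "par x = u" using childrenD[OF x] by auto
  have uV: "u \<in> V" using u by (simp add: inner_def)
  have "anc u x" using anc_par_iff[of x u] anc_refl xV uV by simp
  have "\<not> anc x y"
    using assms(4) not_anc_par[of x] xV anc_trans[OF \<open>anc u x\<close> _ y] by auto
  moreover have "anc y x \<longleftrightarrow> anc y u"
    using anc_par_iff[of x y] xV calculation anc_refl by auto
  ultimately show ?thesis
    using assms(4) anc_refl[OF uV] by (auto simp: scaled_def)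
qed

text \<open>Induction on \<open>S\<close> by removing one of its deepest vertices \<open>u\<close>. The children of \<open>u\<close> have no
  descendants among the remaining indices, so their rows can be reduced by the row of \<open>u\<close>, and
  the pair splits off as a factor.\<close>

lemma det_scaled_below:
  assumes "S \<subseteq> inner" and "\<forall>u\<in>S. par u = c \<or> par u \<in> S"
  shows "det_on (below S) scaled = 4 * (\<Prod>u\<in>S. 4 * ratio u)"
  using assms
proof (induction "card S" arbitrary: S)
  case 0
  then have "S = {}" using finite_inner finite_subset by fastforce
  then show ?case by (simp add: below_def det_children_root)
next
  case (Suc k)
  have fin: "finite S" using Suc.prems(1) finite_inner finite_subset by blast
  have "S \<noteq> {}" using Suc.hyps(2) by auto
  then have "Max ((\<lambda>w. length (branch w)) ` S) \<in> (\<lambda>w. length (branch w)) ` S"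
    using fin by (intro Max_in) auto
  then obtain u where u: "u \<in> S" and "length (branch u) = Max ((\<lambda>w. length (branch w)) ` S)"
    by force
  then have max: "\<forall>w\<in>S. length (branch w) \<le> length (branch u)"
    using fin by simp
  define T where "T = S - {u}"
  have S: "S = insert u T" "u \<notin> T" "finite T" "card T = k"
    using u fin Suc.hyps(2) by (auto simp: T_def)
  have inV: "w \<in> V \<and> w \<noteq> c" if "w \<in> S" for w
    using that Suc.prems(1) by (auto simp: inner_def)
  have uI: "u \<in> inner" using u Suc.prems(1) by blast
  have closed: "\<forall>w\<in>T. par w = c \<or> par w \<in> T"
  proof
    fix w assume w: "w \<in> T"
    then have "par w \<noteq> u"
      using length_branch_par[of w] inV[of w] max by (auto simp: T_def)
    then show "par w = c \<or> par w \<in> T" using w Suc.prems(2) by (auto simp: T_def)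
  qed
  have belowV: "w \<in> V \<and> w \<noteq> c \<and> (par w = c \<or> par w \<in> T)" if "w \<in> below T" for w
    using that childrenD unfolding below_def by blast
  have uT: "u \<in> below T"
    using Suc.prems(2) u inV[OF u] par_neq[of u] by (auto simp: below_def children_def T_def)
  \<comment> \<open>By maximality of its depth, u has no proper descendants in the remaining index set.\<close>
  have rows: "y = u \<or> \<not> anc u y" if "y \<in> below T" for y
  proof (rule ccontr)
    assume "\<not> (y = u \<or> \<not> anc u y)"
    then have a: "y \<noteq> u" "anc u y" by auto
    have y: "y \<in> V" "y \<noteq> c" "par y = c \<or> par y \<in> T" using belowV[OF that] by auto
    have a': "anc u (par y)" using a anc_par_iff[OF y(1,2), of u] by blast
    have "par y \<noteq> c"
    proof
      assume "par y = c"
      then have "u = c" using a' by (simp add: anc_def branch_root)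
      then show False using inV[OF u] by simp
    qed
    then have "par y \<in> T" using y by blast
    then have "u = par y"
      using anc_same_length[OF a' par(1)[OF y(1,2)]] max S(1) by auto
    then show False using \<open>par y \<in> T\<close> S(2) by simp
  qed
  have "below S = below T \<union> children u"
    by (auto simp: below_def S(1))
  moreover have "below T \<inter> children u = {}"
    using belowV childrenD inV[OF u] S(2) by blast
  moreover have "finite (below T)" using finite_children S(3) by (auto simp: below_def)
  ultimately have "det_on (below S) scaled =
      det_on (below T) scaled * det_on (children u) (\<lambda>x y. scaled x y - scaled u y)"
    using det_on_append_children[of "below T" "children u" "\<lambda>_. u" scaled]
      finite_children uT scaled_rows_agree[OF _ uI] rows belowV by simp
  also have "det_on (below T) scaled = 4 * (\<Prod>u\<in>T. 4 * ratio u)"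
    using Suc.prems(1) S closed by (intro Suc.hyps(1)) auto
  also have "\<dots> * det_on (children u) (\<lambda>x y. scaled x y - scaled u y) =
      4 * (\<Prod>u\<in>S. 4 * ratio u)"
    using det_children_inner[OF uI] S by simp
  finally show ?case .
qed

text \<open>Two edges of the same level have lower ends of equal depth. If such edges meet, then in a common
  parent, since a vertex that is the lower end of one and the upper end of the other would give
  different depths. The level is positive exactly if this parent is not the root.\<close>

lemma sibling_pairs_eq: "sibling_pairs V E c = (\<lambda>u. parent_edge ` children u) ` inner"
proof
  show "sibling_pairs V E c \<subseteq> (\<lambda>u. parent_edge ` children u) ` inner"
  proof
    fix p assume "p \<in> sibling_pairs V E c"
    then obtain j k where jk: "p = {j, k}" "j \<in> E" "k \<in> E" "j \<noteq> k" "j \<inter> k \<noteq> {}"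
      "level V E c j = level V E c k" "level V E c j \<noteq> 0"
      unfolding sibling_pairs_def by blast
    then obtain x y where xy: "x \<in> V - {c}" "y \<in> V - {c}" "j = parent_edge x" "k = parent_edge y"
      using bij_betw_imp_surj_on[OF parent_edge_bij] by (metis imageE)
    have "x \<noteq> y" using jk(4) xy by auto
    have lev: "length (branch (par x)) - 1 = length (branch (par y)) - 1"
      "length (branch (par x)) - 1 \<noteq> 0"
      using jk(6,7) level_parent_edge xy by auto
    then have len: "length (branch (par x)) = length (branch (par y))" by simp
    have "par x = par y"
    proof (rule ccontr)
      assume "par x \<noteq> par y"
      then have "par x = y \<or> x = par y"
        using jk(5) xy \<open>x \<noteq> y\<close> by (auto simp: parent_edge_def)
      then show False
        using len length_branch_par[of x] length_branch_par[of y] xy by auto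
    qed
    moreover have "par x \<noteq> c" using lev(2) branch_root by auto
    then have I: "par x \<in> inner" using children_inner_cases[OF xy(1)] by blast
    ultimately have "{x, y} \<subseteq> children (par x)" using xy by (auto simp: children_def)
    moreover have "card {x, y} = 2" using \<open>x \<noteq> y\<close> by simp
    ultimately have "{x, y} = children (par x)"
      using card_children_inner[OF I] finite_children by (intro card_subset_eq) auto
    then have "p = parent_edge ` children (par x)" using jk(1) xy by auto
    then show "p \<in> (\<lambda>u. parent_edge ` children u) ` inner" using I by blast
  qed
  show "(\<lambda>u. parent_edge ` children u) ` inner \<subseteq> sibling_pairs V E c"
  proof clarify
    fix u assume u: "u \<in> inner"
    then obtain x y where xy: "children u = {x, y}" "x \<noteq> y"
      using card_children_inner[OF u] by (auto simp: card_2_iff)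
    then have V: "x \<in> V - {c}" "y \<in> V - {c}" "par x = u" "par y = u"
      using childrenD[of _ u] by auto
    have uV: "u \<in> V" "u \<noteq> c" using u by (auto simp: inner_def)
    have "parent_edge x \<in> E" "parent_edge y \<in> E" "parent_edge x \<noteq> parent_edge y"
      using parent_edge_bij parent_edge_eq_iff V xy(2) by (auto simp: bij_betw_def)
    moreover have "parent_edge x \<inter> parent_edge y \<noteq> {}" using V by (auto simp: parent_edge_def)
    moreover have "level V E c (parent_edge x) = level V E c (parent_edge y)" "level V E c (parent_edge x) \<noteq> 0"
      using level_parent_edge V length_branch_par[OF uV] branch_props(1)[OF par(1)[OF uV]] by auto
    ultimately show "parent_edge ` children u \<in> sibling_pairs V E c"
      unfolding sibling_pairs_def xy(1) image_insert image_empty by blast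
  qed
qed

lemma prod_sibling_pairs:
  "(\<Prod>p\<in>sibling_pairs V E c. 4 * (leaf_number / (\<Sum>i\<in>p. real (n_beyond V E c i)) - 1)) =
   (\<Prod>u\<in>inner. 4 * ratio u)"
proof -
  have inj: "inj_on (\<lambda>u. parent_edge ` children u) inner"
  proof (rule inj_onI)
    fix u w assume uw: "u \<in> inner" "w \<in> inner" "parent_edge ` children u = parent_edge ` children w"
    then have "children u \<noteq> {}" using card_children_inner[of u] by auto
    then obtain x where x: "x \<in> children u" by blast
    then obtain y where y: "y \<in> children w" "parent_edge x = parent_edge y" using uw(3) by blast
    then have "x = y" using x childrenD parent_edge_eq_iff by blast
    then show "u = w" using x y childrenD by blast
  qed
  have sum: "(\<Sum>i\<in>parent_edge ` children u. real (n_beyond V E c i)) = beyond u" if "u \<in> inner" for u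
  proof -
    have "inj_on parent_edge (children u)"
      using childrenD by (intro parent_edge_inj) blast
    then have "(\<Sum>i\<in>parent_edge ` children u. real (n_beyond V E c i)) =
        (\<Sum>w\<in>children u. real (n_beyond V E c (parent_edge w)))"
      by (simp add: sum.reindex)
    also have "\<dots> = (\<Sum>w\<in>children u. beyond w)"
      using childrenD by (intro sum.cong) (auto simp: n_beyond_parent_edge beyond_def)
    also have "\<dots> = beyond u" using beyond_children[of u] that by simp
    finally show ?thesis .
  qed
  show ?thesis
    unfolding sibling_pairs_eq by (simp add: prod.reindex[OF inj] sum ratio_def)
qed

theorem det_Q_mat:
  assumes e: "bij_betw e {..<m} E"
  shows "m = 2 * card (boundary V E) - 3"
    and "det (Q_mat V E m e) =
      4 / (\<Prod>i\<in>E. (leaf_number - real (n_beyond V E c i))\<^sup>2) *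
      (\<Prod>p\<in>sibling_pairs V E c. 4 * (leaf_number / (\<Sum>i\<in>p. real (n_beyond V E c i)) - 1))"
proof -
  define f where "f = inv_into (V - {c}) parent_edge \<circ> e"
  have f: "bij_betw f {..<m} (V - {c})"
    unfolding f_def using e bij_betw_inv_into[OF parent_edge_bij] bij_betw_trans by blast
  have ef: "parent_edge (f i) = e i" if "i < m" for i
    using bij_betw_inv_into_right[OF parent_edge_bij] bij_betwE[OF e] that by (simp add: f_def)
  have fV: "f i \<in> V - {c}" if "i < m" for i
    using bij_betwE[OF f] that by simp
  have "card (V - {c}) = m" using bij_betw_same_card[OF f] by simp
  then show "m = 2 * card (boundary V E) - 3" using card_edges by simp
  let ?d = "\<lambda>x. 1 / (leaf_number - beyond x)"
  have "Q_mat V E m e = mat m m (\<lambda>(i, j). ?d (f i) * scaled (f i) (f j) * ?d (f j))"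
    unfolding Q_mat_def by (rule eq_matI) (simp_all add: Q_entry_parent_edge[OF fV fV] flip: ef)
  then have "det (Q_mat V E m e) = det_on (V - {c}) (\<lambda>x y. ?d x * scaled x y * ?d y)"
    by (simp add: det_on_eq[OF f])
  also have "\<dots> = (\<Prod>x\<in>V - {c}. (?d x)\<^sup>2) * det_on (below inner) scaled"
    unfolding below_inner using finite_V by (intro det_on_scale) simp
  also have "det_on (below inner) scaled = 4 * (\<Prod>u\<in>inner. 4 * ratio u)"
    using children_inner_cases by (intro det_scaled_below) (auto simp: inner_def)
  also have "(\<Prod>x\<in>V - {c}. (?d x)\<^sup>2) = 1 / (\<Prod>x\<in>V - {c}. (leaf_number - beyond x)\<^sup>2)"
    by (simp add: power_one_over prod_dividef)
  also have "(\<Prod>x\<in>V - {c}. (leaf_number - beyond x)\<^sup>2) =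
      (\<Prod>i\<in>E. (leaf_number - real (n_beyond V E c i))\<^sup>2)"
    by (subst prod.reindex_bij_betw[OF parent_edge_bij, symmetric])
      (simp add: n_beyond_parent_edge beyond_def)
  finally show "det (Q_mat V E m e) =
      4 / (\<Prod>i\<in>E. (leaf_number - real (n_beyond V E c i))\<^sup>2) *
      (\<Prod>p\<in>sibling_pairs V E c. 4 * (leaf_number / (\<Sum>i\<in>p. real (n_beyond V E c i)) - 1))"
    by (simp only: prod_sibling_pairs)
qed

end

theorem proposition4:
  fixes V :: "'a set" and E :: "'a set set" and c :: 'a
    and n m :: nat and e :: "nat \<Rightarrow> 'a set"
  assumes "binary_tree V E"
    and "n = card (boundary V E)"
    and "c \<in> V" and "vdegree E c = 3"
    and "bij_betw e {..<m} E"
  shows "m = 2 * n - 3 \<and>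
    det (Q_mat V E m e) =
      4 / (\<Prod>i\<in>E. (real n - real (n_beyond V E c i))\<^sup>2) *
      (\<Prod>p\<in>sibling_pairs V E c. 4 * (real n / (\<Sum>i\<in>p. real (n_beyond V E c i)) - 1))"
proof -
  interpret rooted_binary_tree V E c
    using assms(1,3,4) by unfold_locales (auto simp: binary_tree_def)
  show ?thesis
    using det_Q_mat[OF assms(5)] by (simp add: assms(2))
qed

end
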